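(* Let $m,n\ge 2$ be integers, let $p$ be a prime number, and put $k:=\nu_p(n)$. Let $S_m^n:=\{x_1^n+\cdots+x_m^n : x_1,\dots,x_m\in\mathbb{Z}_{\ge0}\}$ and $R(S_m^n):=\{a/b: a,b\in S_m^n,\ b\neq0\}$. Then: (a) If $m\ge\theta(n,p^{2k+1})$, then $R(S_m^n)$ is dense in $\mathbb{Q}_p$. (b) If $m<\theta(n,p^{2k+1})$ and $(n,p)\notin\{(2,2),(4,2),(8,2),(16,2)\}$, then $R(S_m^n)$ is not dense in $\mathbb{Q}_p$. (c) $R(S_m^2)$ is dense in $\mathbb{Q}_2$ if and only if $m\ge3$. (d) $R(S_m^4)$ is dense in $\mathbb{Q}_2$ if and only if $m\ge8$. (e) $R(S_m^8)$ is dense in $\mathbb{Q}_2$ if and only if $m\ge16$. (f) $R(S_m^{16})$ is dense in $\mathbb{Q}_2$ if and only if $m\ge64$.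
   Context: $\nu_p$ denotes the $p$-adic valuation. For integers $n,b\ge2$, $\theta(n,b)$ is the smallest positive integer $g$ such that the congruence $X_1^n+\cdots+X_g^n\equiv 0\pmod b$ has an integer solution $(X_1,\dots,X_g)$ with at least one of $X_1,\dots,X_g$ coprime to $b$. *)

theory Defs
  imports "HOL-Analysis.Analysis" "HOL-Number_Theory.Cong"
    "HOL-Computational_Algebra.Squarefree"
begin

section \<open>The field of p-adic numbers as a completion of the rationals\<close>

text \<open>
  The underlying metric space of the p-adic numbers is built as the set of Cauchy sequences of
  rationals for the p-adic metric modulo null sequences. Only its topology and the embedding of
  the rationals are needed, so the field operations are not lifted. The lemmas below show that
  the result is a complete metric space containing the rationals isometrically as a dense subset.
\<close>

definition padic_val :: "nat \<Rightarrow> rat \<Rightarrow> int" where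
  "padic_val p x = int (multiplicity (int p) (fst (quotient_of x)))
                 - int (multiplicity (int p) (snd (quotient_of x)))"

definition padic_abs :: "nat \<Rightarrow> rat \<Rightarrow> real" where
  "padic_abs p x = (if x = 0 then 0 else real p powi (- padic_val p x))"

definition padic_dist :: "nat \<Rightarrow> rat \<Rightarrow> rat \<Rightarrow> real" where
  "padic_dist p x y = padic_abs p (x - y)"

abbreviation padic_Cauchy :: "nat \<Rightarrow> (nat \<Rightarrow> rat) \<Rightarrow> bool" where
  "padic_Cauchy p \<equiv> Metric_space.MCauchy UNIV (padic_dist p)"

definition Qp_rel :: "nat \<Rightarrow> ((nat \<Rightarrow> rat) \<times> (nat \<Rightarrow> rat)) set" where
  "Qp_rel p = {(X, Y). padic_Cauchy p X \<and> padic_Cauchy p Y \<and>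
                       (\<lambda>i. padic_dist p (X i) (Y i)) \<longlonglongrightarrow> 0}"

definition Qp :: "nat \<Rightarrow> (nat \<Rightarrow> rat) set set" where
  "Qp p = {X. padic_Cauchy p X} // Qp_rel p"

text \<open>
  The limit does not depend on the chosen representatives, see \<open>Qp_dist_class\<close>. The value 0 outside
  the carrier is there because \<^locale>\<open>Metric_space\<close> requires nonnegativity on the whole type.
\<close>

definition Qp_dist :: "nat \<Rightarrow> (nat \<Rightarrow> rat) set \<Rightarrow> (nat \<Rightarrow> rat) set \<Rightarrow> real" where
  "Qp_dist p A B =
     (if A \<in> Qp p \<and> B \<in> Qp p
      then lim (\<lambda>i. padic_dist p ((SOME X. X \<in> A) i) ((SOME Y. Y \<in> B) i)) else 0)"

definition Qp_of_rat :: "nat \<Rightarrow> rat \<Rightarrow> (nat \<Rightarrow> rat) set" where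
  "Qp_of_rat p q = Qp_rel p `` {\<lambda>_. q}"

definition Qp_topology :: "nat \<Rightarrow> (nat \<Rightarrow> rat) set topology" where
  "Qp_topology p = Metric_space.mtopology (Qp p) (Qp_dist p)"

definition dense_in_Qp :: "nat \<Rightarrow> rat set \<Rightarrow> bool" where
  "dense_in_Qp p A \<longleftrightarrow>
     Qp_topology p closure_of (Qp_of_rat p ` A) = topspace (Qp_topology p)"


subsection \<open>The construction is well defined\<close>

lemma padic_val_divide:
  assumes p: "prime p" and a: "a \<noteq> 0" and b: "b \<noteq> 0"
  shows "padic_val p (of_int a / of_int b) =
           int (multiplicity (int p) a) - int (multiplicity (int p) b)"
proof -
  obtain c d where q: "quotient_of (of_int a / of_int b) = (c, d)"
    by (cases "quotient_of (of_int a / of_int b)")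
  have d: "d > 0" using quotient_of_denom_pos[OF q] .
  have eq: "(of_int a / of_int b :: rat) = of_int c / of_int d"
    using quotient_of_div[OF q] .
  have c: "c \<noteq> 0" using eq a b d by auto
  have "(of_int (a * d) :: rat) = of_int (c * b)"
    using eq b d by (simp add: field_simps)
  hence "a * d = c * b" by (simp only: of_int_eq_iff)
  moreover have "prime_elem (int p)" using p by simp
  ultimately have "multiplicity (int p) a + multiplicity (int p) d =
             multiplicity (int p) c + multiplicity (int p) b"
    using a b c d prime_elem_multiplicity_mult_distrib[of "int p"]
    by (metis less_irrefl)
  thus ?thesis unfolding padic_val_def q by simp
qed

lemma padic_abs_nonneg: "0 \<le> padic_abs p x"
  by (simp add: padic_abs_def)

lemma padic_abs_eq_0_iff:
  assumes "prime p" shows "padic_abs p x = 0 \<longleftrightarrow> x = 0"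
  using assms by (auto simp: padic_abs_def prime_gt_0_nat)

lemma common_denominator:
  fixes x y :: rat
  obtains a b d :: int where "x = of_int a / of_int d" "y = of_int b / of_int d" "d \<noteq> 0"
proof -
  obtain a c where x: "quotient_of x = (a, c)" by (cases "quotient_of x")
  obtain b e where y: "quotient_of y = (b, e)" by (cases "quotient_of y")
  have "c > 0" "e > 0" using quotient_of_denom_pos[OF x] quotient_of_denom_pos[OF y] .
  moreover have "x = of_int (a * e) / of_int (c * e)" "y = of_int (b * c) / of_int (c * e)"
    using quotient_of_div[OF x] quotient_of_div[OF y] calculation by auto
  ultimately show thesis using that[of "a * e" "c * e" "b * c"] by simp
qed

lemma padic_abs_uminus:
  assumes "prime p" shows "padic_abs p (- x) = padic_abs p x"
proof -
  obtain a b d :: int where "x = of_int a / of_int d" "x = of_int b / of_int d" "d \<noteq> 0"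
    by (rule common_denominator[of x x])
  hence x: "x = of_int a / of_int d" "- x = of_int (- a) / of_int d" "d \<noteq> 0" by auto
  show ?thesis
  proof (cases "a = 0")
    case False
    hence "padic_val p (- x) = padic_val p x"
      using padic_val_divide[OF assms, of a d] padic_val_divide[OF assms, of "- a" d] x
      by (simp add: multiplicity_uminus_right)
    thus ?thesis by (simp add: padic_abs_def)
  qed (simp add: x)
qed

lemma padic_abs_add_le_max:
  assumes "prime p"
  shows "padic_abs p (x + y) \<le> max (padic_abs p x) (padic_abs p y)"
proof (cases "x = 0 \<or> y = 0 \<or> x + y = 0")
  case True
  thus ?thesis using padic_abs_nonneg by (auto simp: padic_abs_def le_max_iff_disj)
next
  case False
  obtain a b d :: int where *: "x = of_int a / of_int d" "y = of_int b / of_int d" "d \<noteq> 0"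
    by (rule common_denominator[of x y])
  have xy: "x + y = of_int (a + b) / of_int d" using * by (simp add: add_divide_distrib)
  have nz: "a \<noteq> 0" "b \<noteq> 0" "a + b \<noteq> 0" using False * xy by auto
  let ?m = "min (multiplicity (int p) a) (multiplicity (int p) b)"
  have "int p ^ ?m dvd a + b"
    by (intro dvd_add multiplicity_dvd') auto
  hence "?m \<le> multiplicity (int p) (a + b)"
    using nz assms by (intro multiplicity_geI) (auto dest: prime_gt_1_nat)
  hence "min (padic_val p x) (padic_val p y) \<le> padic_val p (x + y)"
    unfolding xy unfolding *(1,2) padic_val_divide[OF assms nz(1) *(3)]
      padic_val_divide[OF assms nz(2) *(3)] padic_val_divide[OF assms nz(3) *(3)] by linarith
  moreover have "real p powi (- u) \<le> real p powi (- v)" if "v \<le> u" for u v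
    using that prime_gt_1_nat[OF assms] by (intro power_int_increasing) auto
  ultimately show ?thesis using False unfolding padic_abs_def
    by (auto simp: le_max_iff_disj min_le_iff_disj)
qed

lemma Metric_space_padic_dist:
  assumes "prime p" shows "Metric_space UNIV (padic_dist p)"
proof
  fix x y z
  show "0 \<le> padic_dist p x y" by (simp add: padic_dist_def padic_abs_nonneg)
  show "padic_dist p x y = padic_dist p y x"
    using padic_abs_uminus[OF assms, of "x - y"] by (simp add: padic_dist_def)
  show "padic_dist p x y = 0 \<longleftrightarrow> x = y"
    by (simp add: padic_dist_def padic_abs_eq_0_iff[OF assms])
  have "padic_abs p (x - z) \<le> max (padic_abs p (x - y)) (padic_abs p (y - z))"
    using padic_abs_add_le_max[OF assms, of "x - y" "y - z"] by simp
  thus "padic_dist p x z \<le> padic_dist p x y + padic_dist p y z"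
    using padic_abs_nonneg[of p "x - y"] padic_abs_nonneg[of p "y - z"]
    by (simp add: padic_dist_def)
qed

lemma padic_dist_convergent:
  assumes p: "prime p" and X: "padic_Cauchy p X" and Y: "padic_Cauchy p Y"
  shows "convergent (\<lambda>i. padic_dist p (X i) (Y i))"
proof -
  interpret Metric_space UNIV "padic_dist p" by (rule Metric_space_padic_dist[OF p])
  have "Cauchy (\<lambda>i. padic_dist p (X i) (Y i))"
  proof (rule metric_CauchyI)
    fix e :: real assume e: "0 < e"
    obtain M where M: "\<And>i j. M \<le> i \<Longrightarrow> M \<le> j \<Longrightarrow> padic_dist p (X i) (X j) < e / 2"
      using X e unfolding MCauchy_def by (meson half_gt_zero)
    obtain N where N: "\<And>i j. N \<le> i \<Longrightarrow> N \<le> j \<Longrightarrow> padic_dist p (Y i) (Y j) < e / 2"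
      using Y e unfolding MCauchy_def by (meson half_gt_zero)
    have "dist (padic_dist p (X i) (Y i)) (padic_dist p (X j) (Y j)) < e"
      if "max M N \<le> i" "max M N \<le> j" for i j
      using M[of i j] N[of i j] that
        triangle[of "X i" "X j" "Y i"] triangle[of "X j" "Y j" "Y i"]
        triangle[of "X j" "X i" "Y j"] triangle[of "X i" "Y i" "Y j"]
        commute[of "X i" "X j"] commute[of "Y i" "Y j"]
      by (auto simp: dist_real_def abs_less_iff)
    thus "\<exists>M. \<forall>m\<ge>M. \<forall>n\<ge>M.
        dist (padic_dist p (X m) (Y m)) (padic_dist p (X n) (Y n)) < e" by blast
  qed
  thus ?thesis by (rule Cauchy_convergent)
qed

lemma equiv_Qp_rel:
  assumes p: "prime p" shows "equiv {X. padic_Cauchy p X} (Qp_rel p)"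
proof -
  interpret Metric_space UNIV "padic_dist p" by (rule Metric_space_padic_dist[OF p])
  show ?thesis
  proof (rule equivI)
    show "Qp_rel p \<subseteq> {X. padic_Cauchy p X} \<times> {X. padic_Cauchy p X}"
      by (auto simp: Qp_rel_def)
    show "refl_on {X. padic_Cauchy p X} (Qp_rel p)"
      by (auto simp: refl_on_def Qp_rel_def)
    show "sym (Qp_rel p)"
      using commute by (auto simp: sym_def Qp_rel_def)
    show "trans (Qp_rel p)"
    proof (rule transI)
      fix X Y Z assume "(X, Y) \<in> Qp_rel p" "(Y, Z) \<in> Qp_rel p"
      hence *: "padic_Cauchy p X" "padic_Cauchy p Z"
          "(\<lambda>i. padic_dist p (X i) (Y i)) \<longlonglongrightarrow> 0" "(\<lambda>i. padic_dist p (Y i) (Z i)) \<longlonglongrightarrow> 0"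
        by (auto simp: Qp_rel_def)
      have "(\<lambda>i. padic_dist p (X i) (Z i)) \<longlonglongrightarrow> 0"
        by (rule tendsto_sandwich[OF _ _ tendsto_const tendsto_add_zero[OF *(3,4)]])
           (auto intro!: always_eventually triangle)
      thus "(X, Z) \<in> Qp_rel p" using * by (simp add: Qp_rel_def)
    qed
  qed
qed

lemma Qp_dist_class:
  assumes p: "prime p" and A: "A \<in> Qp p" "X \<in> A" and B: "B \<in> Qp p" "Y \<in> B"
  shows "(\<lambda>i. padic_dist p (X i) (Y i)) \<longlonglongrightarrow> Qp_dist p A B"
proof -
  interpret Metric_space UNIV "padic_dist p" by (rule Metric_space_padic_dist[OF p])
  define X' where "X' = (SOME X. X \<in> A)"
  define Y' where "Y' = (SOME Y. Y \<in> B)"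
  have "X' \<in> A" "Y' \<in> B" unfolding X'_def Y'_def using A B by (metis someI)+
  hence X: "(X, X') \<in> Qp_rel p" and Y: "(Y', Y) \<in> Qp_rel p"
    using quotient_eq_iff[OF equiv_Qp_rel[OF p]] A B unfolding Qp_def by blast+
  have lim: "(\<lambda>i. padic_dist p (X' i) (Y' i)) \<longlonglongrightarrow> Qp_dist p A B"
    using padic_dist_convergent[OF p, of X' Y'] X Y
    unfolding Qp_dist_def X'_def[symmetric] Y'_def[symmetric]
    using A B by (simp add: convergent_LIMSEQ_iff Qp_rel_def)
  have bound: "norm (padic_dist p (X i) (Y i) - padic_dist p (X' i) (Y' i))
      \<le> padic_dist p (X i) (X' i) + padic_dist p (Y' i) (Y i)" for i
    using triangle[of "X i" "X' i" "Y i"] triangle[of "X' i" "Y' i" "Y i"]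
        triangle[of "X' i" "X i" "Y' i"] triangle[of "X i" "Y i" "Y' i"]
        commute[of "X i" "X' i"] commute[of "Y i" "Y' i"] by simp
  have null: "(\<lambda>i. padic_dist p (X i) (X' i) + padic_dist p (Y' i) (Y i)) \<longlonglongrightarrow> 0"
    using X Y by (intro tendsto_add_zero) (auto simp: Qp_rel_def)
  have "(\<lambda>i. padic_dist p (X i) (Y i) - padic_dist p (X' i) (Y' i)) \<longlonglongrightarrow> 0"
    by (rule Lim_null_comparison[OF always_eventually null]) (use bound in blast)
  from tendsto_add[OF this lim] show ?thesis by simp
qed

lemma Qp_nonempty_class:
  assumes "prime p" "A \<in> Qp p"
  obtains X where "X \<in> A" "padic_Cauchy p X" "A = Qp_rel p `` {X}"
proof -
  obtain X where X: "padic_Cauchy p X" "A = Qp_rel p `` {X}"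
    using assms(2) by (auto simp: Qp_def quotient_def)
  with equiv_class_self[OF equiv_Qp_rel[OF assms(1)]] that show thesis by blast
qed

lemma Qp_of_rat:
  assumes "prime p"
  shows "Qp_of_rat p q \<in> Qp p" "(\<lambda>_. q) \<in> Qp_of_rat p q"
proof -
  interpret Metric_space UNIV "padic_dist p" by (rule Metric_space_padic_dist[OF assms])
  show "Qp_of_rat p q \<in> Qp p"
    unfolding Qp_of_rat_def Qp_def by (intro quotientI) simp
  show "(\<lambda>_. q) \<in> Qp_of_rat p q"
    unfolding Qp_of_rat_def by (intro equiv_class_self[OF equiv_Qp_rel[OF assms]]) simp
qed

lemma Qp_dist_of_rat:
  assumes "prime p" shows "Qp_dist p (Qp_of_rat p x) (Qp_of_rat p y) = padic_dist p x y"
  using Qp_dist_class[OF assms Qp_of_rat[OF assms, of x] Qp_of_rat[OF assms, of y]]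
  by (simp add: LIMSEQ_const_iff)

lemma Metric_space_Qp:
  assumes p: "prime p" shows "Metric_space (Qp p) (Qp_dist p)"
proof -
  interpret Metric_space UNIV "padic_dist p" by (rule Metric_space_padic_dist[OF p])
  show ?thesis
  proof
    fix A B
    show "0 \<le> Qp_dist p A B"
    proof (cases "A \<in> Qp p \<and> B \<in> Qp p")
      case True
      then obtain X Y where "X \<in> A" "Y \<in> B" using Qp_nonempty_class[OF p] by metis
      with True have "(\<lambda>i. padic_dist p (X i) (Y i)) \<longlonglongrightarrow> Qp_dist p A B"
        by (intro Qp_dist_class[OF p]) auto
      thus ?thesis by (rule LIMSEQ_le_const) simp
    qed (auto simp: Qp_dist_def)
    show "Qp_dist p A B = Qp_dist p B A"
      unfolding Qp_dist_def by (subst commute) auto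
  next
    fix A B assume AB: "A \<in> Qp p" "B \<in> Qp p"
    obtain X where X: "X \<in> A" "padic_Cauchy p X" "A = Qp_rel p `` {X}"
      using Qp_nonempty_class[OF p AB(1)] .
    obtain Y where Y: "Y \<in> B" "padic_Cauchy p Y" "B = Qp_rel p `` {Y}"
      using Qp_nonempty_class[OF p AB(2)] .
    have lim: "(\<lambda>i. padic_dist p (X i) (Y i)) \<longlonglongrightarrow> Qp_dist p A B"
      by (rule Qp_dist_class[OF p AB(1) X(1) AB(2) Y(1)])
    have "Qp_dist p A B = 0 \<longleftrightarrow> (X, Y) \<in> Qp_rel p"
      using lim X(2) Y(2) LIMSEQ_unique by (fastforce simp: Qp_rel_def)
    also have "\<dots> \<longleftrightarrow> A = B"
      using eq_equiv_class_iff[OF equiv_Qp_rel[OF p], of X Y] X Y by simp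
    finally show "Qp_dist p A B = 0 \<longleftrightarrow> A = B" .
    fix C assume C: "C \<in> Qp p"
    then obtain Z where Z: "Z \<in> C" using Qp_nonempty_class[OF p] by metis
    show "Qp_dist p A C \<le> Qp_dist p A B + Qp_dist p B C"
      using Qp_dist_class[OF p AB(1) X(1) C Z]
        tendsto_add[OF lim Qp_dist_class[OF p AB(2) Y(1) C Z]]
      by (rule LIMSEQ_le) (auto intro: triangle)
  qed
qed

lemma topspace_Qp [simp]: "prime p \<Longrightarrow> topspace (Qp_topology p) = Qp p"
  by (simp add: Qp_topology_def Metric_space.topspace_mtopology[OF Metric_space_Qp])

text \<open>A Cauchy sequence of rationals converges to its own class.\<close>

lemma Qp_of_rat_approx:
  assumes p: "prime p" and A: "A \<in> Qp p" "X \<in> A"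
  shows "(\<lambda>i. Qp_dist p A (Qp_of_rat p (X i))) \<longlonglongrightarrow> 0"
proof -
  interpret Q: Metric_space "Qp p" "Qp_dist p" by (rule Metric_space_Qp[OF p])
  obtain Y where Y: "Y \<in> A" "A = Qp_rel p `` {Y}" using Qp_nonempty_class[OF p A(1)] by metis
  hence cau: "padic_Cauchy p X" using A by (auto simp: Qp_rel_def)
  show ?thesis
  proof (rule LIMSEQ_I)
    fix e :: real assume e: "0 < e"
    obtain N where N: "\<And>i j. N \<le> i \<Longrightarrow> N \<le> j \<Longrightarrow> padic_dist p (X i) (X j) < e / 2"
      using cau e unfolding Metric_space.MCauchy_def[OF Metric_space_padic_dist[OF p]]
      by (meson half_gt_zero)
    have "Qp_dist p A (Qp_of_rat p (X i)) < e" if i: "N \<le> i" for i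
    proof -
      have "Qp_dist p A (Qp_of_rat p (X i)) \<le> e / 2"
        by (rule LIMSEQ_le_const2[OF Qp_dist_class[OF p A Qp_of_rat[OF p]]])
           (use N i in \<open>auto intro!: exI[of _ N] less_imp_le\<close>)
      thus ?thesis using e by simp
    qed
    thus "\<exists>N. \<forall>i\<ge>N. norm (Qp_dist p A (Qp_of_rat p (X i)) - 0) < e" by auto
  qed
qed

lemma dense_in_Qp_UNIV:
  assumes p: "prime p" shows "dense_in_Qp p UNIV"
proof -
  interpret Q: Metric_space "Qp p" "Qp_dist p" by (rule Metric_space_Qp[OF p])
  have "\<exists>q. Qp_dist p A (Qp_of_rat p q) < r" if A: "A \<in> Qp p" and r: "0 < r" for A r
  proof -
    obtain X where "X \<in> A" using Qp_nonempty_class[OF p A] by metis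
    from order_tendstoD(2)[OF Qp_of_rat_approx[OF p A this] r] show ?thesis
      by (auto simp: eventually_sequentially)
  qed
  thus ?thesis
    using Qp_of_rat(1)[OF p]
    by (auto simp: dense_in_Qp_def topspace_Qp[OF p] Qp_topology_def Q.metric_closure_of)
qed

lemma mcomplete_Qp:
  assumes p: "prime p" shows "Metric_space.mcomplete (Qp p) (Qp_dist p)"
proof -
  interpret Metric_space UNIV "padic_dist p" by (rule Metric_space_padic_dist[OF p])
  interpret Q: Metric_space "Qp p" "Qp_dist p" by (rule Metric_space_Qp[OF p])
  show ?thesis unfolding Q.mcomplete_def
  proof (intro allI impI)
    fix \<sigma> assume \<sigma>: "Q.MCauchy \<sigma>"
    hence in_Qp: "\<sigma> i \<in> Qp p" for i by (auto simp: Q.MCauchy_def)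
    have "\<exists>q. Qp_dist p (\<sigma> i) (Qp_of_rat p q) < inverse (real (Suc i))" for i
    proof -
      obtain X where "X \<in> \<sigma> i" using Qp_nonempty_class[OF p in_Qp] by metis
      from order_tendstoD(2)[OF Qp_of_rat_approx[OF p in_Qp this], of "inverse (real (Suc i))"]
      show ?thesis by (auto simp: eventually_sequentially)
    qed
    then obtain X where X: "\<And>i. Qp_dist p (\<sigma> i) (Qp_of_rat p (X i)) < inverse (real (Suc i))"
      by metis
    have lim: "(\<lambda>i. Qp_dist p (\<sigma> i) (Qp_of_rat p (X i))) \<longlonglongrightarrow> 0"
      by (rule tendsto_sandwich[OF _ _ tendsto_const LIMSEQ_inverse_real_of_nat])
         (use X in \<open>auto intro!: always_eventually less_imp_le simp del: of_nat_Suc\<close>)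
    have "padic_Cauchy p X" unfolding MCauchy_def
    proof (intro conjI allI impI)
      fix e :: real assume e: "0 < e"
      obtain M where M: "\<And>i j. M \<le> i \<Longrightarrow> M \<le> j \<Longrightarrow> Qp_dist p (\<sigma> i) (\<sigma> j) < e / 3"
        using \<sigma> e unfolding Q.MCauchy_def by (metis zero_less_divide_iff zero_less_numeral)
      obtain N where N: "\<And>i. N \<le> i \<Longrightarrow> Qp_dist p (\<sigma> i) (Qp_of_rat p (X i)) < e / 3"
        using order_tendstoD(2)[OF lim, of "e / 3"] e by (auto simp: eventually_sequentially)
      have "padic_dist p (X i) (X j) < e" if "max M N \<le> i" "max M N \<le> j" for i j
      proof -
        let ?x = "Qp_of_rat p (X i)" and ?y = "Qp_of_rat p (X j)"
        note mem = in_Qp[of i] in_Qp[of j] Qp_of_rat(1)[OF p, of "X i"] Qp_of_rat(1)[OF p, of "X j"]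
        have "Qp_dist p ?x ?y \<le> Qp_dist p ?x (\<sigma> i) + Qp_dist p (\<sigma> i) ?y"
          by (rule Q.triangle) (use mem in auto)
        also have "Qp_dist p (\<sigma> i) ?y \<le> Qp_dist p (\<sigma> i) (\<sigma> j) + Qp_dist p (\<sigma> j) ?y"
          by (rule Q.triangle) (use mem in auto)
        finally show ?thesis
          using M[of i j] N[of i] N[of j] that Q.commute[of ?x "\<sigma> i"]
          by (simp add: Qp_dist_of_rat[OF p])
      qed
      thus "\<exists>N. \<forall>n n'. N \<le> n \<longrightarrow> N \<le> n' \<longrightarrow> padic_dist p (X n) (X n') < e" by blast
    qed simp
    hence A: "Qp_rel p `` {X} \<in> Qp p" "X \<in> Qp_rel p `` {X}"
      using equiv_class_self[OF equiv_Qp_rel[OF p]] by (auto simp: Qp_def intro: quotientI)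
    let ?A = "Qp_rel p `` {X}"
    have "(\<lambda>i. Qp_dist p (\<sigma> i) ?A) \<longlonglongrightarrow> 0"
    proof (rule tendsto_sandwich[OF _ _ tendsto_const
            tendsto_add_zero[OF lim Qp_of_rat_approx[OF p A]]])
      show "\<forall>\<^sub>F i in sequentially. Qp_dist p (\<sigma> i) ?A
          \<le> Qp_dist p (\<sigma> i) (Qp_of_rat p (X i)) + Qp_dist p ?A (Qp_of_rat p (X i))"
        using Q.triangle[OF in_Qp Qp_of_rat(1)[OF p] A(1)] Q.commute
        by (intro always_eventually) metis
    qed simp
    hence "limitin Q.mtopology \<sigma> ?A sequentially"
      using A(1) in_Qp by (simp add: Q.limitin_metric_dist_null)
    thus "\<exists>A. limitin Q.mtopology \<sigma> A sequentially" by blast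
  qed
qed


section \<open>Sums of powers\<close>

definition power_sums :: "nat \<Rightarrow> nat \<Rightarrow> nat set" where
  "power_sums m n = {\<Sum>i<m. x i ^ n | x :: nat \<Rightarrow> nat. True}"

definition ratio_set :: "nat set \<Rightarrow> rat set" where
  "ratio_set S = {of_nat a / of_nat b | a b. a \<in> S \<and> b \<in> S \<and> b \<noteq> 0}"

text \<open>Such a \<open>g\<close> always exists for \<open>b > 0\<close>: take \<open>g = b\<close> and all \<open>X i = 1\<close>.\<close>

definition theta :: "nat \<Rightarrow> nat \<Rightarrow> nat" where
  "theta n b = (LEAST g. 0 < g \<and>
     (\<exists>X :: nat \<Rightarrow> int. [(\<Sum>i<g. X i ^ n) = 0] (mod int b) \<and> (\<exists>i<g. coprime (X i) (int b))))"

end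

theory Submission
  imports Defs
begin

text \<open>
  Hensel lifting shows that as soon as an integer t is congruent modulo p^(2k+1) to a sum of m n-th
  powers with one base prime to p, it is a p-adic limit of such sums. If m is at least theta, all
  multiples of p^(2k+1) are therefore limits, and these have every rational as a quotient.

  If m is less than theta, a sum divisible by p^(2k+1) has all its bases divisible by p, so
  valuations of nonzero sums lie in {0,...,2k} modulo n. When 4k+2 is at most n, no quotient has
  valuation 2k+1. For odd n, theta is at most 2 because 1 + (-1)^n = 0, and for even n the inequality
  fails only in the four exceptional cases.

  In those cases odd n-th powers are 1 modulo 4n. For n = 2, 4, 8 the obstruction is that -1 is
  not a limit of quotients unless some 2m powers, not all even, sum to 0 modulo 4n; for n = 16
  it is again the gap of valuations, with 6 in place of 2k+1.
\<close>

section \<open>Density in terms of integers\<close>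

text \<open>The rationals embed isometrically and densely, so a class can be replaced by a rational
  within \<open>e / 2\<close>. From here on the completion no longer appears.\<close>

lemma dense_in_Qp_iff:
  assumes p: "prime p"
  shows "dense_in_Qp p A \<longleftrightarrow> (\<forall>q. \<forall>e>0. \<exists>r\<in>A. padic_dist p q r < e)"
proof -
  interpret Q: Metric_space "Qp p" "Qp_dist p" by (rule Metric_space_Qp[OF p])
  note mem = Qp_of_rat(1)[OF p]
  have "dense_in_Qp p A \<longleftrightarrow> (\<forall>B\<in>Qp p. \<forall>e>0. \<exists>r\<in>A. Qp_dist p B (Qp_of_rat p r) < e)"
    using mem
    by (auto simp: dense_in_Qp_def topspace_Qp[OF p] Qp_topology_def Q.metric_closure_of)
  also have "\<dots> \<longleftrightarrow> (\<forall>q. \<forall>e>0. \<exists>r\<in>A. padic_dist p q r < e)" (is "?L \<longleftrightarrow> ?R")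
  proof
    assume ?L thus ?R using mem by (metis Qp_dist_of_rat[OF p])
  next
    assume R: ?R
    show ?L
    proof (intro ballI allI impI)
      fix B and e :: real assume B: "B \<in> Qp p" and e: "0 < e"
      obtain X where "X \<in> B" using Qp_nonempty_class[OF p B] by metis
      from order_tendstoD(2)[OF Qp_of_rat_approx[OF p B this], of "e / 2"] e
      obtain q where q: "Qp_dist p B (Qp_of_rat p q) < e / 2"
        by (auto simp: eventually_sequentially)
      obtain r where r: "r \<in> A" "padic_dist p q r < e / 2" using R e by (meson half_gt_zero)
      have "Qp_dist p B (Qp_of_rat p r) < e"
        using Q.triangle[OF B mem[of q] mem[of r]] q r by (simp add: Qp_dist_of_rat[OF p])
      thus "\<exists>r\<in>A. Qp_dist p B (Qp_of_rat p r) < e" using r by blast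
    qed
  qed
  finally show ?thesis .
qed

text \<open>The difference of the fractions is \<open>(a * d - c * b) / (b * d)\<close>, and the
  valuation of \<open>b * d\<close> is additive. The zero difference is treated apart because it has
  no valuation.\<close>

lemma padic_dist_le_iff:
  fixes a b c d :: int
  assumes p: "prime p" and "b \<noteq> 0" "d \<noteq> 0"
  shows "padic_dist p (of_int a / of_int b) (of_int c / of_int d) \<le> real p powi (- int N) \<longleftrightarrow>
    int p ^ (N + multiplicity (int p) b + multiplicity (int p) d) dvd a * d - c * b"
proof -
  have eq: "(of_int a / of_int b - of_int c / of_int d :: rat) = of_int (a * d - c * b) / of_int (b * d)"
    using assms by (simp add: field_simps)
  show ?thesis
  proof (cases "a * d - c * b = 0")
    case True
    thus ?thesis using p by (simp add: padic_dist_def eq padic_abs_def del: of_int_diff of_int_mult)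
  next
    case False
    have mono: "real p powi (- x) \<le> real p powi (- int N) \<longleftrightarrow> int N \<le> x" for x
      using prime_gt_1_nat[OF p] power_int_increasing[of "- x" "- int N" "real p"]
        power_int_strict_increasing[of "- int N" "- x" "real p"] by force
    have mult: "multiplicity (int p) (b * d) = multiplicity (int p) b + multiplicity (int p) d"
      using assms by (intro prime_elem_multiplicity_mult_distrib) auto
    have nu: "\<not> is_unit (int p)" using prime_gt_1_nat[OF p] by simp
    have bd: "b * d \<noteq> 0" using assms by simp
    have "padic_dist p (of_int a / of_int b) (of_int c / of_int d) =
        real p powi (- (int (multiplicity (int p) (a * d - c * b)) - int (multiplicity (int p) (b * d))))"
      unfolding padic_dist_def eq padic_abs_def padic_val_divide[OF p False bd]
      using False bd by (simp del: of_int_diff of_int_mult)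
    thus ?thesis
      using mono mult by (simp only: power_dvd_iff_le_multiplicity[OF False nu]) linarith
  qed
qed

text \<open>The radii \<open>real p powi (- int N)\<close> are arbitrarily small. The valuation of
  \<open>int B\<close> enters the exponent because \<open>B\<close> may be highly divisible by
  \<open>p\<close>, so the error has to be small relative to it.\<close>

lemma dense_ratio_set_iff:
  assumes p: "prime p"
  shows "dense_in_Qp p (ratio_set S) \<longleftrightarrow>
    (\<forall>a b::int. \<forall>N. b \<noteq> 0 \<longrightarrow> (\<exists>A\<in>S. \<exists>B\<in>S. B \<noteq> 0 \<and>
       int p ^ (N + multiplicity (int p) b + multiplicity (int p) (int B)) dvd a * int B - int A * b))"
    (is "_ \<longleftrightarrow> ?R")
proof
  assume D: "dense_in_Qp p (ratio_set S)"
  show ?R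
  proof (intro allI impI)
    fix a b :: int and N assume b: "b \<noteq> 0"
    have "real p powi (- int N) > 0" using prime_gt_0_nat[OF p] by simp
    then obtain r where r: "r \<in> ratio_set S"
        "padic_dist p (of_int a / of_int b) r < real p powi (- int N)"
      using D unfolding dense_in_Qp_iff[OF p] by blast
    then obtain A B where AB: "A \<in> S" "B \<in> S" "B \<noteq> 0" "r = of_int (int A) / of_int (int B)"
      by (auto simp: ratio_set_def)
    hence "int p ^ (N + multiplicity (int p) b + multiplicity (int p) (int B)) dvd a * int B - int A * b"
      using r b by (subst padic_dist_le_iff[OF p, symmetric]) auto
    thus "\<exists>A\<in>S. \<exists>B\<in>S. B \<noteq> 0 \<and>
       int p ^ (N + multiplicity (int p) b + multiplicity (int p) (int B)) dvd a * int B - int A * b"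
      using AB by blast
  qed
next
  assume R: ?R
  show "dense_in_Qp p (ratio_set S)" unfolding dense_in_Qp_iff[OF p]
  proof (intro allI impI)
    fix q :: rat and e :: real assume e: "0 < e"
    obtain a b :: int where ab: "q = of_int a / of_int b" "b \<noteq> 0"
      by (metis Fract_of_int_quotient Rat_cases less_irrefl)
    obtain N where N: "(1 / real p) ^ N < e"
      using real_arch_pow_inv[OF e, of "1 / real p"] prime_gt_1_nat[OF p] by auto
    obtain A B where AB: "A \<in> S" "B \<in> S" "B \<noteq> 0"
       "int p ^ (N + multiplicity (int p) b + multiplicity (int p) (int B)) dvd a * int B - int A * b"
      using R ab by blast
    have "padic_dist p q (of_int (int A) / of_int (int B)) \<le> real p powi (- int N)"
      using AB ab by (simp only: padic_dist_le_iff[OF p] of_nat_eq_0_iff not_False_eq_True)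
    also have "\<dots> < e" using N by (simp add: power_int_minus power_one_over divide_inverse power_inverse)
    finally show "\<exists>r\<in>ratio_set S. padic_dist p q r < e"
      using AB by (auto simp: ratio_set_def)
  qed
qed

section \<open>Integers in the p-adic closure of a set of naturals\<close>

text \<open>Adherence to \<open>S\<close> in the p-adic topology, phrased by congruences so that
  limits of elements of \<open>S\<close> can be handled inside the integers.\<close>

definition padic_adherent :: "nat \<Rightarrow> nat set \<Rightarrow> int \<Rightarrow> bool" where
  "padic_adherent p S t \<longleftrightarrow> (\<forall>N. \<exists>A\<in>S. [int A = t] (mod int p ^ N))"

lemma padic_adherentI: "s \<in> S \<Longrightarrow> padic_adherent p S (int s)"
  unfolding padic_adherent_def using cong_refl by blast

lemma padic_adherent_mono: "padic_adherent p S t \<Longrightarrow> S \<subseteq> T \<Longrightarrow> padic_adherent p T t"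
  by (meson padic_adherent_def subsetD)

text \<open>If \<open>a / b = t / u\<close> with \<open>t\<close> and \<open>u\<close> adherent,
  elements of \<open>S\<close> close to \<open>t\<close> and \<open>u\<close> have a ratio close to
  \<open>a / b\<close>, since \<open>u\<close> is nonzero. The target 0 is met exactly by
  \<open>0 / s\<close>, and signs are moved so that \<open>b\<close> is positive.\<close>

lemma dense_ratio_setI:
  assumes p: "prime p" and S: "0 \<in> S" "s \<in> S" "s \<noteq> 0"
    and frac: "\<And>a b::int. a \<noteq> 0 \<Longrightarrow> b > 0 \<Longrightarrow>
      \<exists>t u. padic_adherent p S t \<and> padic_adherent p S u \<and> u \<noteq> 0 \<and> a * u = t * b"
  shows "dense_in_Qp p (ratio_set S)"
  unfolding dense_ratio_set_iff[OF p]
proof (intro allI impI)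
  fix a b :: int and N assume b: "b \<noteq> 0"
  have nu: "\<not> is_unit (int p)" using prime_gt_1_nat[OF p] by simp
  show "\<exists>A\<in>S. \<exists>B\<in>S. B \<noteq> 0 \<and>
    int p ^ (N + multiplicity (int p) b + multiplicity (int p) (int B)) dvd a * int B - int A * b"
  proof (cases "a = 0")
    case True
    thus ?thesis using S by (intro bexI[of _ 0] bexI[of _ s]) auto
  next
    case False
    obtain t u where tu: "padic_adherent p S t" "padic_adherent p S u" "u \<noteq> 0" "a * u = t * b"
    proof (cases "b > 0")
      case True thus ?thesis using frac[of a b] False that by blast
    next
      case neg: False
      then obtain t u where "padic_adherent p S t" "padic_adherent p S u" "u \<noteq> 0"
          "(- a) * u = t * (- b)"
        using frac[of "- a" "- b"] False b by force
      thus ?thesis using that by simp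
    qed
    \<comment> \<open>The summand 1 puts \<open>K\<close> above the valuation of \<open>u\<close>,
      so any \<open>B\<close> congruent to \<open>u\<close> modulo \<open>int p ^ K\<close> is
      nonzero and has the same valuation as \<open>u\<close>.\<close>
    define K where "K = N + multiplicity (int p) b + multiplicity (int p) u + 1"
    obtain A B where A: "A \<in> S" "[int A = t] (mod int p ^ K)"
      and B: "B \<in> S" "[int B = u] (mod int p ^ K)"
      using tu unfolding padic_adherent_def by meson
    let ?w = "multiplicity (int p) u"
    have dvd_iff: "int p ^ j dvd int B \<longleftrightarrow> int p ^ j dvd u" if "j \<le> K" for j
      using cong_dvd_modulus[OF B(2) le_imp_power_dvd[OF that]] cong_dvd_iff by blast
    have B1: "int p ^ ?w dvd int B" "\<not> int p ^ Suc ?w dvd int B"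
      using dvd_iff[of ?w] dvd_iff[of "Suc ?w"] tu(3) nu
      by (auto simp: multiplicity_dvd K_def power_dvd_iff_le_multiplicity simp del: power_Suc)
    hence B0: "B \<noteq> 0" by (metis dvd_0_right of_nat_0)
    have w: "multiplicity (int p) (int B) = ?w" by (intro multiplicity_eqI B1)
    have "[a * int B - int A * b = a * u - t * b] (mod int p ^ K)"
      by (intro cong_diff cong_mult A B cong_refl)
    hence "int p ^ K dvd a * int B - int A * b" using tu(4) by (simp add: cong_0_iff)
    hence "int p ^ (N + multiplicity (int p) b + ?w) dvd a * int B - int A * b"
      by (rule power_le_dvd) (simp add: K_def)
    thus ?thesis using A B B0 w by metis
  qed
qed

lemma multiplicity_of_nat: "multiplicity (int p) (int a) = multiplicity p a"
  by (simp add: multiplicity_def flip: of_nat_power)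

section \<open>Hensel lifting of power congruences\<close>

text \<open>The first-order Taylor expansion of the n-th power, with the remainder left implicit; it
  supplies the Newton step below.\<close>

lemma power_add_expand:
  fixes y h :: "'a::comm_ring_1"
  shows "\<exists>c. (y + h) ^ n = y ^ n + of_nat n * y ^ (n - 1) * h + h\<^sup>2 * c"
proof (induction n)
  case 0
  show ?case by (intro exI[of _ 0]) simp
next
  case (Suc n)
  then obtain c where c: "(y + h) ^ n = y ^ n + of_nat n * y ^ (n - 1) * h + h\<^sup>2 * c" by blast
  have *: "of_nat n * (y * y ^ (n - 1)) = of_nat n * y ^ n" by (cases n) auto
  have "(y + h) ^ Suc n = (y + h) * (y ^ n + of_nat n * y ^ (n - 1) * h + h\<^sup>2 * c)"
    by (simp add: c)
  also have "\<dots> = y * y ^ n + of_nat n * (y * y ^ (n - 1)) * h + y ^ n * h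
      + h\<^sup>2 * (of_nat n * y ^ (n - 1) + (y + h) * c)"
    by (simp add: algebra_simps power2_eq_square)
  also have "\<dots> = y ^ Suc n + of_nat (Suc n) * y ^ (Suc n - 1) * h
      + h\<^sup>2 * (of_nat n * y ^ (n - 1) + (y + h) * c)"
    unfolding * by (simp add: algebra_simps)
  finally show ?case by blast
qed

text \<open>For \<open>y\<close> prime to \<open>p\<close>, the derivative
  \<open>n * y ^ (n - 1)\<close> has valuation exactly \<open>k\<close>. Hence moving
  \<open>y\<close> by multiples of \<open>p ^ (M - k)\<close> corrects an error at level
  \<open>p ^ M\<close>, and the precision grows by one in each step.\<close>

lemma hensel_power:
  fixes x u :: int
  assumes p: "prime p" and n: "n > 0" and x: "\<not> int p dvd x"
    and cong: "[x ^ n = u] (mod int p ^ (2 * multiplicity p n + 1))"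
  shows "\<exists>y. \<not> int p dvd y \<and> [y ^ n = u] (mod int p ^ N)"
proof -
  define k where "k = multiplicity p n"
  obtain n' where n': "n = p ^ k * n'" "\<not> p dvd n'"
    unfolding k_def using n p by (elim multiplicity_decompose'[of n p, rotated 2])
      (auto simp: prime_gt_1_nat dest: prime_gt_1_nat)
  have pp: "prime (int p)" using p by simp
  have lift: "\<exists>y. \<not> int p dvd y \<and> [y ^ n = u] (mod int p ^ (2 * k + 1 + j))" for j
  proof (induction j)
    case 0
    thus ?case using x cong by (auto simp: k_def)
  next
    case (Suc j)
    define M where "M = 2 * k + 1 + j"
    obtain y w where y: "\<not> int p dvd y" and w: "y ^ n = u + int p ^ M * w"
      using Suc by (auto simp: cong_iff_dvd_diff M_def elim!: dvdE) (metis add.commute diff_add_cancel)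
    have cop: "coprime (int n' * y ^ (n - 1)) (int p)"
      using y n'(2) p pp
      by (simp add: coprime_commute[of _ "int p"] prime_imp_coprime prime_imp_coprime_nat)
    \<comment> \<open>\<open>z\<close> is chosen so that the linear term cancels the error
      \<open>w\<close> modulo \<open>p\<close>; its coefficient is a unit after \<open>p ^ k\<close>
      has been split off from \<open>n\<close>.\<close>
    obtain z where z: "[int n' * y ^ (n - 1) * z = - w] (mod int p)"
      using cong_solve_coprime_int[OF cop] by (metis cong_scalar_right mult.assoc mult_1)
    define h where "h = int p ^ (M - k) * z"
    obtain c where c: "(y + h) ^ n = y ^ n + int n * y ^ (n - 1) * h + h\<^sup>2 * c"
      using power_add_expand by blast
    have e1: "int p ^ k * int p ^ (M - k) = int p ^ M"
      unfolding power_add[symmetric] by (rule arg_cong[of _ _ "(^) (int p)"]) (simp add: M_def)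
    \<comment> \<open>The quadratic term is negligible because
      \<open>2 * (M - k) \<ge> M + 1\<close>, which is exactly \<open>M \<ge> 2 * k + 1\<close>.
      This is the origin of the modulus \<open>p ^ (2 * k + 1)\<close>.\<close>
    have e2: "int p ^ Suc M dvd h\<^sup>2 * c"
      unfolding h_def power_mult_distrib power_mult[symmetric]
      by (intro dvd_mult2 le_imp_power_dvd) (simp add: M_def)
    have "int n * y ^ (n - 1) * h = (int p ^ k * int p ^ (M - k)) * (int n' * y ^ (n - 1) * z)"
      by (simp add: n'(1) h_def mult_ac)
    hence "(y + h) ^ n - u = int p ^ M * (int n' * y ^ (n - 1) * z - (- w)) + h\<^sup>2 * c"
      using c w e1 by (simp add: algebra_simps)
    moreover have "int p ^ Suc M dvd int p ^ M * (int n' * y ^ (n - 1) * z - (- w))"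
      using z by (auto simp: cong_iff_dvd_diff mult.commute[of "int p"] simp del: diff_minus_eq_add)
    ultimately have "[(y + h) ^ n = u] (mod int p ^ Suc M)"
      using e2 by (simp only: cong_iff_dvd_diff dvd_add)
    moreover have "int p dvd h" by (simp add: h_def M_def dvd_power)
    hence "\<not> int p dvd y + h" using y by (simp add: dvd_add_left_iff)
    ultimately show ?case by (auto simp: M_def)
  qed
  obtain y where "\<not> int p dvd y" "[y ^ n = u] (mod int p ^ (2 * k + 1 + N))" using lift by blast
  thus ?thesis using cong_dvd_modulus le_imp_power_dvd[of N "2 * k + 1 + N" "int p"] by fastforce
qed

section \<open>Sums of powers\<close>

lemma power_sumsI: "(\<Sum>i<m. x i ^ n) \<in> power_sums m n"
  by (auto simp: power_sums_def)

lemma power_sums_mono: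
  assumes "m \<le> m'" "n > 0"
  shows "power_sums m n \<subseteq> power_sums m' n"
proof
  fix s assume "s \<in> power_sums m n"
  then obtain x where s: "s = (\<Sum>i<m. x i ^ n)" by (auto simp: power_sums_def)
  have "(\<Sum>i<m'. (if i < m then x i else 0) ^ n) = (\<Sum>i<m. (if i < m then x i else 0) ^ n)"
    using assms by (intro sum.mono_neutral_right) auto
  thus "s \<in> power_sums m' n" using power_sumsI[of "\<lambda>i. if i < m then x i else 0" n m'] s by simp
qed

lemma le_in_power_sums: "j \<le> m \<Longrightarrow> n > 0 \<Longrightarrow> j \<in> power_sums m n"
  using power_sums_mono[of j m n] power_sumsI[of "\<lambda>_. 1" n j] by auto

lemma power_mult_in_power_sums:
  assumes "s \<in> power_sums m n"
  shows "z ^ n * s \<in> power_sums m n"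
proof -
  obtain x where "s = (\<Sum>i<m. x i ^ n)" using assms by (auto simp: power_sums_def)
  hence "z ^ n * s = (\<Sum>i<m. (z * x i) ^ n)" by (simp add: sum_distrib_left power_mult_distrib)
  thus ?thesis using power_sumsI by metis
qed

lemma padic_adherent_power_mult:
  assumes "padic_adherent p (power_sums m n) t"
  shows "padic_adherent p (power_sums m n) (int z ^ n * t)"
  unfolding padic_adherent_def
proof
  fix N
  obtain A where "A \<in> power_sums m n" "[int A = t] (mod int p ^ N)"
    using assms by (auto simp: padic_adherent_def)
  thus "\<exists>A\<in>power_sums m n. [int A = int z ^ n * t] (mod int p ^ N)"
    using power_mult_in_power_sums[of A m n z]
    by (intro bexI[of _ "z ^ n * A"]) (auto intro!: cong_mult)
qed

text \<open>All bases but the one prime to \<open>p\<close> stay fixed with total \<open>r\<close>;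
  Hensel lifting moves the remaining base until its power approximates
  \<open>t - int r\<close>.\<close>

lemma padic_adherent_power_sumsI:
  assumes p: "prime p" and n: "n > 0" and i: "i < m" "\<not> p dvd x i"
    and cong: "[int (\<Sum>i<m. x i ^ n) = t] (mod int p ^ (2 * multiplicity p n + 1))"
  shows "padic_adherent p (power_sums m n) t"
  unfolding padic_adherent_def
proof
  fix N
  define r where "r = (\<Sum>j\<in>{..<m} - {i}. x j ^ n)"
  have split: "(\<Sum>j<m. (x(i := y)) j ^ n) = y ^ n + r" for y
    using i by (subst sum.remove[of _ i]) (auto simp: r_def intro!: sum.cong)
  have "[int (x i) ^ n = t - int r] (mod int p ^ (2 * multiplicity p n + 1))"
    using cong unfolding cong_iff_dvd_diff split[of "x i", simplified]
    by (simp add: algebra_simps)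
  then obtain y where y: "[y ^ n = t - int r] (mod int p ^ N)"
    using hensel_power[OF p n] i(2) by (metis int_dvd_int_iff)
  \<comment> \<open>The lifted base may be negative, whereas \<open>power_sums\<close> takes natural
    bases, so it is reduced modulo \<open>p ^ N\<close>.\<close>
  define z where "z = nat (y mod int p ^ N)"
  have "[int z = y] (mod int p ^ N)" using prime_gt_0_nat[OF p] by (simp add: z_def)
  hence "[int z ^ n = t - int r] (mod int p ^ N)" using y cong_pow cong_trans by blast
  hence "[int (z ^ n + r) = t] (mod int p ^ N)" by (simp add: cong_iff_dvd_diff algebra_simps)
  thus "\<exists>A\<in>power_sums m n. [int A = t] (mod int p ^ N)"
    using power_sumsI[of "x(i := z)"] split by metis
qed

text \<open>One free base and \<open>m - 1\<close> ones suffice to reach the residues needed for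
  fourth and eighth powers.\<close>

lemma padic_adherent_count:
  assumes p: "prime p" and n: "n > 0" and m: "m > 0" and z: "\<not> p dvd z"
    and cong: "[int (z ^ n + (m - 1)) = t] (mod int p ^ (2 * multiplicity p n + 1))"
  shows "padic_adherent p (power_sums m n) t"
proof -
  have "(\<Sum>i<m. ((\<lambda>_. 1)(0 := z)) i ^ n) = z ^ n + (m - 1)"
    using m by (subst sum.remove[of _ 0]) auto
  thus ?thesis using assms by (intro padic_adherent_power_sumsI[where i = 0 and x = "(\<lambda>_. 1)(0 := z)"]) auto
qed

section \<open>Two obstructions to density\<close>

text \<open>The sums have no primitive zero modulo \<open>p ^ L\<close>. Both obstructions use this
  to divide a highly divisible sum by \<open>p ^ n\<close> and obtain another sum of
  \<open>m\<close> powers.\<close>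

definition only_imprimitive :: "nat \<Rightarrow> nat \<Rightarrow> nat \<Rightarrow> nat \<Rightarrow> bool" where
  "only_imprimitive m n p L \<longleftrightarrow>
     (\<forall>x::nat \<Rightarrow> nat. p ^ L dvd (\<Sum>i<m. x i ^ n) \<longrightarrow> (\<forall>i<m. p dvd x i))"

lemma all_dvd_power_sum:
  fixes x :: "nat \<Rightarrow> nat"
  assumes "\<forall>i<m. p dvd x i"
  shows "(\<Sum>i<m. x i ^ n) = p ^ n * (\<Sum>i<m. (x i div p) ^ n)"
  using assms by (auto simp: sum_distrib_left simp flip: power_mult_distrib)

text \<open>Valuations of nonzero sums have residues below \<open>L\<close> modulo \<open>n\<close>,
  so the valuation of a ratio is never \<open>L\<close> modulo \<open>n\<close> when
  \<open>2 * L \<le> n\<close>. Thus \<open>p ^ L\<close> is not a limit of ratios.\<close>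

lemma not_dense_exponent_gap:
  assumes p: "prime p" and oi: "only_imprimitive m n p L" and L: "2 * L \<le> n" and n: "n > 0"
  shows "\<not> dense_in_Qp p (ratio_set (power_sums m n))"
proof
  assume D: "dense_in_Qp p (ratio_set (power_sums m n))"
  have nu: "\<not> is_unit p" "\<not> is_unit (int p)" using prime_gt_1_nat[OF p] by auto
  have pe: "prime_elem p" using p by auto
  \<comment> \<open>Descent: a sum divisible by \<open>p ^ L\<close> is \<open>p ^ n\<close> times a
    smaller sum, and otherwise its valuation is already below \<open>L\<close>.\<close>
  have val: "multiplicity p s mod n < L" if "s \<in> power_sums m n" "s \<noteq> 0" for s
    using that
  proof (induction s rule: less_induct)
    case (less s)
    then obtain x where s: "s = (\<Sum>i<m. x i ^ n)" by (auto simp: power_sums_def)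
    show ?case
    proof (cases "p ^ L dvd s")
      case True
      hence dv: "\<forall>i<m. p dvd x i" using oi s by (auto simp: only_imprimitive_def)
      define s' where "s' = (\<Sum>i<m. (x i div p) ^ n)"
      have s': "s = p ^ n * s'" using all_dvd_power_sum[OF dv] s by (simp add: s'_def)
      hence nz: "s' \<noteq> 0" using less.prems by auto
      have "1 < p ^ n" using prime_gt_1_nat[OF p] n one_less_power by blast
      hence "s' < s" using s' nz by simp
      hence "multiplicity p s' mod n < L" 
        using less.IH[of s'] nz power_sumsI[of "\<lambda>i. x i div p" n m] unfolding s'_def by blast
      moreover have "multiplicity p s = n + multiplicity p s'"
        using s' nz pe p by (simp add: prime_elem_multiplicity_mult_distrib prime_gt_0_nat)
      ultimately show ?thesis by simp
    next
      case False
      hence "multiplicity p s < L" using less.prems nu by (simp add: power_dvd_iff_le_multiplicity)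
      thus ?thesis by (meson le_less_trans mod_less_eq_dividend)
    qed
  qed
  \<comment> \<open>The precision \<open>Suc L\<close> exceeds the valuation of the target
    \<open>p ^ L\<close>, which forces \<open>A\<close> to have exactly the valuation of
    \<open>p ^ L * B\<close>.\<close>
  obtain A B where AB: "A \<in> power_sums m n" "B \<in> power_sums m n" "B \<noteq> 0"
    "int p ^ (Suc L + multiplicity (int p) 1 + multiplicity (int p) (int B)) dvd int p ^ L * int B - int A * 1"
    using D[unfolded dense_ratio_set_iff[OF p], rule_format, of 1 "Suc L" "int p ^ L"] by auto
  define v where "v = L + multiplicity p B"
  have "multiplicity (int p) (int B) = multiplicity p B"
    by (simp add: multiplicity_of_nat)
  hence cong: "[int p ^ L * int B = int A] (mod int p ^ Suc v)"
    using AB(4) by (simp add: cong_iff_dvd_diff v_def)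
  have "multiplicity p (p ^ L * B) = v"
    using AB(3) pe p by (simp add: v_def prime_elem_multiplicity_mult_distrib prime_gt_0_nat)
  hence pB: "p ^ v dvd p ^ L * B" "\<not> p ^ Suc v dvd p ^ L * B"
    using AB(3) nu p by (auto simp: power_dvd_iff_le_multiplicity prime_gt_0_nat simp del: power_Suc)
  have "int (p ^ j) dvd int (p ^ L * B) \<longleftrightarrow> int (p ^ j) dvd int A" if "j \<le> Suc v" for j
    using cong_dvd_iff[OF cong_dvd_modulus[OF cong le_imp_power_dvd[OF that]]] by simp
  hence "p ^ j dvd p ^ L * B \<longleftrightarrow> p ^ j dvd A" if "j \<le> Suc v" for j
    using that by (simp only: int_dvd_int_iff)
  from this[of v] this[of "Suc v"] pB have "p ^ v dvd A" "\<not> p ^ Suc v dvd A" by simp_all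
  hence "multiplicity p A = v" "A \<noteq> 0" by (blast intro: multiplicity_eqI, metis dvd_0_right)
  hence "v mod n < L" using val AB by blast
  \<comment> \<open>No wrap-around occurs, because the right-hand side is less than
    \<open>2 * L\<close>, hence less than \<open>n\<close>.\<close>
  moreover have "v mod n = L + multiplicity p B mod n"
    using val[OF AB(2,3)] L mod_add_right_eq[of L "multiplicity p B" n] by (simp add: v_def)
  ultimately show False by simp
qed

text \<open>If -1 were a limit of ratios A/B, then A + B would be a sum of 2m powers of high valuation
  compared to B; dividing all bases by p preserves this, which gives an infinite descent.\<close>

lemma not_dense_minus_one:
  assumes p: "prime p" and n: "n > 0" and oi: "only_imprimitive (2 * m) n p L"
  shows "\<not> dense_in_Qp p (ratio_set (power_sums m n))"
proof
  assume D: "dense_in_Qp p (ratio_set (power_sums m n))"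
  have descent: "False" if "p ^ (L + multiplicity p B) dvd A + B" "A = (\<Sum>i<m. x i ^ n)"
    "B = (\<Sum>i<m. y i ^ n)" "B \<noteq> 0" for A B and x y :: "nat \<Rightarrow> nat"
    using that
  proof (induction B arbitrary: A x y rule: less_induct)
    case (less B)
    \<comment> \<open>The bases of \<open>A\<close> and \<open>B\<close> are concatenated into one
      sum of \<open>2 * m\<close> powers.\<close>
    define z where "z i = (if i < m then x i else y (i - m))" for i
    have "(\<Sum>i<2*m. z i ^ n) = (\<Sum>i<m. z i ^ n) + (\<Sum>i=m..<m+m. z i ^ n)"
      by (simp add: lessThan_atLeast0 mult_2 sum.atLeastLessThan_concat)
    also have "(\<Sum>i=m..<m+m. z i ^ n) = (\<Sum>i<m. z (i + m) ^ n)"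
      using sum.shift_bounds_nat_ivl[of "\<lambda>i. z i ^ n" 0 m m] by (simp add: lessThan_atLeast0)
    finally have "(\<Sum>i<2*m. z i ^ n) = A + B" using less.prems by (simp add: z_def)
    hence "p ^ L dvd (\<Sum>i<2*m. z i ^ n)" using less.prems(1) power_le_dvd le_add1 by metis
    hence zd: "\<forall>i<2*m. p dvd z i" using oi by (auto simp: only_imprimitive_def)
    have "p dvd x i" "p dvd y i" if "i < m" for i
      using zd[rule_format, of i] zd[rule_format, of "i + m"] that by (auto simp: z_def)
    hence xy: "\<forall>i<m. p dvd x i" "\<forall>i<m. p dvd y i" by blast+
    define A' B' where "A' = (\<Sum>i<m. (x i div p) ^ n)" and "B' = (\<Sum>i<m. (y i div p) ^ n)"
    have eqs: "A = p ^ n * A'" "B = p ^ n * B'"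
      using all_dvd_power_sum[OF xy(1)] all_dvd_power_sum[OF xy(2)] less.prems
      by (auto simp: A'_def B'_def)
    have nz: "B' \<noteq> 0" using eqs less.prems by auto
    have "1 < p ^ n" using prime_gt_1_nat[OF p] n one_less_power by blast
    hence lt: "B' < B" using eqs nz by simp
    \<comment> \<open>The valuation of \<open>B\<close> falls by \<open>n\<close>, the same amount
      as the power of \<open>p\<close> cancelled from \<open>A + B\<close>, so the excess
      \<open>L\<close> survives the descent.\<close>
    have "multiplicity p B = n + multiplicity p B'"
      using eqs nz p by (simp add: prime_elem_multiplicity_mult_distrib prime_gt_0_nat)
    hence "p ^ n * p ^ (L + multiplicity p B') dvd p ^ n * (A' + B')"
      using less.prems(1) eqs by (simp add: algebra_simps power_add)
    hence "p ^ (L + multiplicity p B') dvd A' + B'" using prime_gt_0_nat[OF p] by simp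
    from less.IH[OF lt this A'_def B'_def nz] show False .
  qed
  obtain A B where AB: "A \<in> power_sums m n" "B \<in> power_sums m n" "B \<noteq> 0"
    "int p ^ (L + multiplicity (int p) 1 + multiplicity (int p) (int B)) dvd (- 1) * int B - int A * 1"
    using D[unfolded dense_ratio_set_iff[OF p], rule_format, of 1 L "- 1"] by auto
  have "multiplicity (int p) (int B) = multiplicity p B"
    by (simp add: multiplicity_of_nat)
  moreover have "(- 1) * int B - int A * 1 = - int (A + B)" by simp
  ultimately have "int (p ^ (L + multiplicity p B)) dvd int (A + B)"
    using AB(4) by (simp only: dvd_minus_iff multiplicity_one add_0_right of_nat_power)
  hence "p ^ (L + multiplicity p B) dvd A + B" by (simp only: int_dvd_int_iff)
  moreover obtain x y where "A = (\<Sum>i<m. x i ^ n)" "B = (\<Sum>i<m. y i ^ n)"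
    using AB by (auto simp: power_sums_def)
  ultimately show False using descent AB(3) by blast
qed

text \<open>The sum is congruent modulo \<open>2 ^ L\<close> to the number of odd bases, which is at
  most \<open>m\<close> and so too small to be a nonzero multiple of \<open>2 ^ L\<close>.\<close>

lemma only_imprimitive_counting:
  assumes m: "m < 2 ^ L"
    and odd: "\<And>z::nat. odd z \<Longrightarrow> z ^ n mod 2 ^ L = 1" and even: "\<And>z::nat. even z \<Longrightarrow> z ^ n mod 2 ^ L = 0"
  shows "only_imprimitive m n 2 L"
  unfolding only_imprimitive_def
proof (intro allI impI)
  fix x :: "nat \<Rightarrow> nat" and i
  assume dv: "2 ^ L dvd (\<Sum>i<m. x i ^ n)" and i: "i < m"
  have "(\<Sum>i<m. x i ^ n) mod 2 ^ L = (\<Sum>i<m. x i ^ n mod 2 ^ L) mod 2 ^ L"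
    by (rule mod_sum_eq[symmetric])
  also have "(\<Sum>i<m. x i ^ n mod 2 ^ L) = (\<Sum>i<m. of_bool (odd (x i)))"
    using odd even by (intro sum.cong) auto
  also have "\<dots> = card {i\<in>{..<m}. odd (x i)}" by (subst sum_of_bool_eq) (auto simp: Int_def)
  also have "card {i\<in>{..<m}. odd (x i)} \<le> m"
    using card_mono[of "{..<m}" "{i\<in>{..<m}. odd (x i)}"] by auto
  hence "card {i\<in>{..<m}. odd (x i)} mod 2 ^ L = card {i\<in>{..<m}. odd (x i)}" using m by simp
  finally have "card {i\<in>{..<m}. odd (x i)} = 0" using dv by simp
  thus "2 dvd x i" using i by auto
qed

section \<open>Powers modulo powers of two\<close>

lemma odd_mod_4_8:
  fixes z :: int
  assumes "odd z"
  shows "z mod 8 \<in> {1, 3, 5, 7}" and "z mod 4 \<in> {1, 3}"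
proof -
  have parity: "odd (z mod 8)" "odd (z mod 4)" using assms by (simp_all add: dvd_mod_iff)
  have "z mod 8 \<in> {0..<8}" "z mod 4 \<in> {0..<4}" by simp_all
  moreover have "{0..<8} = {0, 1, 2, 3, 4, 5, 6, 7::int}" "{0..<4} = {0, 1, 2, 3::int}" by auto
  ultimately have "z mod 8 \<in> {0, 1, 2, 3, 4, 5, 6, 7}" "z mod 4 \<in> {0, 1, 2, 3}" by simp_all
  moreover have "\<lbrakk>u \<in> {0, 1, 2, 3, 4, 5, 6, 7}; odd u\<rbrakk> \<Longrightarrow> u \<in> {1, 3, 5, 7}"
    "\<lbrakk>u \<in> {0, 1, 2, 3}; odd u\<rbrakk> \<Longrightarrow> u \<in> {1, 3}" for u :: int
    by auto
  ultimately show "z mod 8 \<in> {1, 3, 5, 7}" "z mod 4 \<in> {1, 3}" using parity by metis+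
qed

text \<open>An odd square is 1 modulo 8, and each further squaring gains a factor 2 from
  \<open>y\<^sup>2 - 1 = (y + 1) * (y - 1)\<close>. With \<open>n = 2 ^ Suc j\<close> the modulus is
  \<open>4 * n\<close>.\<close>

lemma odd_power_two_power_cong_1:
  fixes z :: int
  assumes "odd z"
  shows "2 ^ (j + 3) dvd z ^ (2 ^ Suc j) - 1"
proof (induction j)
  case 0
  have "(z mod 8)\<^sup>2 mod 8 = 1" using odd_mod_4_8(1)[OF assms] by auto
  hence "z\<^sup>2 mod 8 = 1" by (simp add: power_mod)
  thus ?case using mod_eq_dvd_iff[of "z\<^sup>2" 8 1] by simp
next
  case (Suc j)
  have "2 ^ Suc (Suc j) = 2 ^ Suc j + (2 ^ Suc j :: nat)" by simp
  hence eq: "z ^ (2 ^ Suc (Suc j)) - 1 = (z ^ (2 ^ Suc j) + 1) * (z ^ (2 ^ Suc j) - 1)"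
    by (simp only: power_add) (simp only: algebra_simps)
  have "even (z ^ (2 ^ Suc j) + 1)" using assms by simp
  hence "2 * 2 ^ (j + 3) dvd z ^ (2 ^ Suc (Suc j)) - 1"
    unfolding eq using Suc.IH by (rule mult_dvd_mono)
  thus ?case by (simp only: add_Suc power_Suc[of _ "j + 3"])
qed

lemma odd_power_two_power_mod:
  fixes z :: nat
  assumes "odd z"
  shows "z ^ (2 ^ Suc j) mod 2 ^ (j + 3) = 1"
proof -
  have "odd (int z)" using assms by simp
  hence "[int (z ^ (2 ^ Suc j)) = int 1] (mod int (2 ^ (j + 3)))"
    unfolding cong_iff_dvd_diff of_nat_power of_nat_numeral of_nat_1
    by (rule odd_power_two_power_cong_1)
  hence "z ^ (2 ^ Suc j) mod 2 ^ (j + 3) = 1 mod 2 ^ (j + 3)"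
    by (simp only: cong_int_iff) (simp only: cong_def)
  moreover have "(1::nat) < 2 ^ (j + 3)" by (rule one_less_power) auto
  ultimately show ?thesis by (simp only: mod_less)
qed

text \<open>The bound \<open>j + 3 \<le> n\<close> makes even powers vanish modulo
  \<open>4 * n\<close>. It fails for squares, where \<open>j = 0\<close>; they are treated
  separately below.\<close>

lemma only_imprimitive_two_power:
  assumes "n = 2 ^ Suc j" "j + 3 \<le> n" "m < 2 ^ (j + 3)"
  shows "only_imprimitive m n 2 (j + 3)"
proof (rule only_imprimitive_counting[OF assms(3)])
  fix z :: nat
  show "z ^ n mod 2 ^ (j + 3) = 1" if "odd z"
    unfolding assms(1) using that by (rule odd_power_two_power_mod)
  show "z ^ n mod 2 ^ (j + 3) = 0" if "even z"
  proof -
    have "2 ^ (j + 3) dvd (2::nat) ^ n" using assms(2) by (rule le_imp_power_dvd)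
    also have "\<dots> dvd z ^ n" using that by (rule dvd_power_same)
    finally show ?thesis by (rule dvd_imp_mod_0)
  qed
qed

text \<open>Modulo 8 an even square can be 4, so counting works only modulo 4: none or all four
  squares are odd. Four odd squares add up to 4 modulo 8, which rules out the second case.\<close>

lemma only_imprimitive_four_squares: "only_imprimitive (2 * 2) 2 2 3"
  unfolding only_imprimitive_def
proof (intro allI impI)
  fix x :: "nat \<Rightarrow> nat" and i :: nat
  assume dv: "2 ^ 3 dvd (\<Sum>i<2*2. (x i)\<^sup>2)" and i: "i < 2 * 2"
  have o: "(x i)\<^sup>2 mod 8 = 1" if "odd (x i)" for i
    using odd_power_two_power_mod[OF that, of 0] by simp
  have e: "(x i)\<^sup>2 mod 4 = 0" if "even (x i)" for i
    using dvd_power_same[OF that, of 2] by (intro dvd_imp_mod_0) simp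
  have c: "(x i)\<^sup>2 mod 8 = 1 \<or> (x i)\<^sup>2 mod 4 = 0" for i
    using o[of i] e[of i] by (cases "odd (x i)") simp_all
  have sum: "8 dvd (x 0)\<^sup>2 + (x 1)\<^sup>2 + (x 2)\<^sup>2 + (x 3)\<^sup>2"
  proof -
    have "{..<2 * 2} = {0, 1, 2, 3::nat}" by auto
    thus ?thesis using dv by (simp add: add_ac)
  qed
  have all0: "a mod 4 = 0 \<and> b mod 4 = 0 \<and> c mod 4 = 0 \<and> d mod 4 = 0"
    if dvd: "8 dvd a + b + c + d" and res: "a mod 8 = 1 \<or> a mod 4 = 0" "b mod 8 = 1 \<or> b mod 4 = 0"
      "c mod 8 = 1 \<or> c mod 4 = 0" "d mod 8 = 1 \<or> d mod 4 = 0" for a b c d :: nat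
  proof -
    have mod4: "u mod 4 = u mod 8 mod 4" for u :: nat by (simp add: mod_mod_cancel)
    have bound: "u mod 4 \<le> 1" if "u mod 8 = 1 \<or> u mod 4 = 0" for u :: nat
      using that
    proof
      assume "u mod 8 = 1"
      hence "u mod 4 = 1 mod 4" using mod4[of u] by (simp only:)
      thus ?thesis by simp
    qed simp
    have red: "(a mod l + b mod l + c mod l + d mod l) mod l = (a + b + c + d) mod l" for l
      unfolding cong_def[symmetric] by (intro cong_add) simp_all
    have sum8: "(a mod 8 + b mod 8 + c mod 8 + d mod 8) mod 8 = 0"
      using dvd_imp_mod_0[OF dvd] by (simp only: red)
    have "4 dvd a + b + c + d" using dvd by (rule dvd_trans[rotated]) simp
    from dvd_imp_mod_0[OF this] have sum4: "(a mod 4 + b mod 4 + c mod 4 + d mod 4) mod 4 = 0"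
      by (simp only: red)
    have bits: "u = 0 \<and> v = 0 \<and> w = 0 \<and> t = 0 \<or> u = 1 \<and> v = 1 \<and> w = 1 \<and> t = 1"
      if sum: "(u + v + w + t) mod 4 = 0" and le: "u \<le> 1" "v \<le> 1" "w \<le> 1" "t \<le> 1" for u v w t :: nat
    proof -
      have "4 dvd u + v + w + t" using sum by (rule mod_0_imp_dvd)
      then obtain r where "u + v + w + t = 4 * r" by (rule dvdE)
      with le show ?thesis by arith
    qed
    from bits[OF sum4 bound[OF res(1)] bound[OF res(2)] bound[OF res(3)] bound[OF res(4)]]
    show ?thesis
    proof
      assume "a mod 4 = 1 \<and> b mod 4 = 1 \<and> c mod 4 = 1 \<and> d mod 4 = 1"
      hence "a mod 8 = 1 \<and> b mod 8 = 1 \<and> c mod 8 = 1 \<and> d mod 8 = 1"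
        using res by (metis zero_neq_one)
      thus ?thesis using sum8 by (simp only:) simp
    qed
  qed
  have "i = 0 \<or> i = 1 \<or> i = 2 \<or> i = 3" using i by auto
  hence "(x i)\<^sup>2 mod 4 = 0" using all0[OF sum c c c c] by metis
  hence "even ((x i)\<^sup>2)" by (metis dvd_trans even_numeral mod_0_imp_dvd)
  thus "2 dvd x i" by simp
qed

section \<open>The threshold theta\<close>

lemma theta_exists_witness:
  assumes "b > 0"
  shows "0 < theta n b \<and> (\<exists>X :: nat \<Rightarrow> int. [(\<Sum>i<theta n b. X i ^ n) = 0] (mod int b) \<and>
    (\<exists>i<theta n b. coprime (X i) (int b)))"
  unfolding theta_def
  by (rule LeastI[of _ b]) (use assms in \<open>auto intro!: exI[of _ "\<lambda>_. 1"] simp: cong_0_iff\<close>)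

lemma theta_le:
  assumes "0 < g" "[(\<Sum>i<g. X i ^ n) = 0] (mod int b)" "i < g" "coprime (X i) (int b)"
  shows "theta n b \<le> g"
  unfolding theta_def using assms by (intro Least_le) blast

text \<open>A witness for \<open>theta\<close> is a zero modulo \<open>P\<close> with a base prime
  to \<open>p\<close>. Hensel lifting then makes every multiple of \<open>P\<close> adherent, and
  \<open>a / b\<close> is the quotient of \<open>P * a\<close> and \<open>P * b\<close>.\<close>

lemma dense_if_theta_le:
  assumes p: "prime p" and n: "n > 0" and m: "theta n (p ^ (2 * multiplicity p n + 1)) \<le> m"
  shows "dense_in_Qp p (ratio_set (power_sums m n))"
proof -
  define P where "P = p ^ (2 * multiplicity p n + 1)"
  have P: "P > 0" using prime_gt_0_nat[OF p] by (simp add: P_def)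
  define g where "g = theta n P"
  obtain X i where X: "[(\<Sum>i<g. X i ^ n) = 0] (mod int P)" "i < g" "coprime (X i) (int P)"
    using theta_exists_witness[OF P, of n] g_def by blast
  define x where "x j = nat (X j mod int P)" for j
  have x: "[int (x j) = X j] (mod int P)" for j using P by (simp add: x_def)
  have "[int (\<Sum>j<g. x j ^ n) = (\<Sum>j<g. X j ^ n)] (mod int P)"
    by (simp, intro cong_sum cong_pow x)
  hence sum: "[int (\<Sum>j<g. x j ^ n) = 0] (mod int P)" using X(1) cong_trans by blast
  have "coprime (int (x i)) (int P)" using x X(3) cong_imp_coprime cong_sym by blast
  hence "\<not> p dvd x i"
    using p by (auto simp: P_def prime_nat_iff dest!: coprime_common_divisor_nat[of _ _ p])
  have adh: "padic_adherent p (power_sums m n) t" if "int P dvd t" for t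
  proof (rule padic_adherent_mono)
    have "[int (\<Sum>j<g. x j ^ n) = t] (mod int P)"
      using sum that by (meson cong_0_iff cong_sym cong_trans)
    thus "padic_adherent p (power_sums g n) t"
      using padic_adherent_power_sumsI[where i = i and x = x and m = g] p n X(2) \<open>\<not> p dvd x i\<close>
      by (simp add: P_def)
    show "power_sums g n \<subseteq> power_sums m n"
      using power_sums_mono m n by (simp add: g_def P_def)
  qed
  have "m \<ge> 1" using X(2) m by (simp add: g_def P_def)
  show ?thesis
  proof (rule dense_ratio_setI[OF p, where s = 1])
    show "0 \<in> power_sums m n" "1 \<in> power_sums m n"
      using le_in_power_sums n \<open>m \<ge> 1\<close> by auto
    fix a b :: int assume "a \<noteq> 0" "b > 0"
    thus "\<exists>t u. padic_adherent p (power_sums m n) t \<and> padic_adherent p (power_sums m n) u \<and>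
        u \<noteq> 0 \<and> a * u = t * b"
      using adh P by (intro exI[of _ "int P * a"] exI[of _ "int P * b"]) auto
  qed simp
qed

text \<open>A base prime to \<open>p\<close> would make the bases a witness for \<open>theta\<close>
  of length \<open>m\<close>, against minimality.\<close>

lemma only_imprimitive_if_less_theta:
  assumes p: "prime p" and m: "0 < m" "m < theta n (p ^ L)"
  shows "only_imprimitive m n p L"
  unfolding only_imprimitive_def
proof (intro allI impI, rule ccontr)
  fix x :: "nat \<Rightarrow> nat" and i
  assume x: "p ^ L dvd (\<Sum>i<m. x i ^ n)" "i < m" "\<not> p dvd x i"
  have "int (p ^ L) dvd int (\<Sum>i<m. x i ^ n)" using x(1) by (simp only: int_dvd_int_iff)
  hence "[(\<Sum>i<m. int (x i) ^ n) = 0] (mod int (p ^ L))" by (simp add: cong_0_iff)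
  moreover have "coprime p (x i)" using p x(3) by (rule prime_imp_coprime_nat)
  hence "coprime (int (x i)) (int (p ^ L))"
    by (simp add: coprime_commute)
  ultimately have "theta n (p ^ L) \<le> m" using theta_le[of m "\<lambda>i. int (x i)"] m x(2) by blast
  thus False using m by simp
qed

text \<open>Leaves only even exponents in the non-density claim, as \<open>m\<close> is at least 2
  there.\<close>

lemma theta_odd_le_2:
  assumes "odd n"
  shows "theta n b \<le> 2"
  by (rule theta_le[where X = "\<lambda>i. if i = 0 then 1 else - 1" and i = 0])
     (use assms in \<open>auto simp: numeral_2_eq_2\<close>)

text \<open>Write \<open>n = p ^ k * r\<close>. For odd \<open>p\<close> the factor \<open>r\<close>
  is even, and \<open>3 ^ k \<ge> 2 * k + 1\<close>. For \<open>p = 2\<close> either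
  \<open>r \<ge> 3\<close> and \<open>k \<ge> 1\<close>, or \<open>n = 2 ^ k\<close>; in the latter
  case the bound holds from \<open>k = 5\<close> on, and the exceptions are
  \<open>k = 1, 2, 3, 4\<close>.\<close>

lemma even_exponent_bound:
  assumes n: "even n" "n \<ge> 2" and p: "prime p"
    and exc: "(n, p) \<notin> {(2, 2), (4, 2), (8, 2), (16, 2)}"
  shows "4 * multiplicity p n + 2 \<le> n"
proof -
  define k where "k = multiplicity p n"
  obtain r where r: "n = p ^ k * r" "\<not> p dvd r"
    unfolding k_def using n p
    by (elim multiplicity_decompose'[of n p, rotated 2])
      (auto simp: prime_gt_1_nat dest: prime_gt_1_nat)
  have r0: "r > 0" using r(2) by (cases r) auto
  have "4 * k + 2 \<le> n"
  proof (cases "p = 2")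
    case False
    hence p3: "p \<ge> 3" "odd p" using p prime_ge_2_nat[OF p] prime_odd_nat[OF p] by auto
    hence "even r" using r n by auto
    hence r2: "r \<ge> 2" using r0 by auto
    have "2 * k + 1 \<le> 3 ^ k" by (induction k) auto
    also have "\<dots> \<le> p ^ k" using p3 by (intro power_mono) auto
    finally have "(2 * k + 1) * 2 \<le> n" unfolding r(1) by (intro mult_le_mono r2)
    thus ?thesis by simp
  next
    case p2: True
    show ?thesis
    proof (cases "r = 1")
      case True
      hence n2: "n = 2 ^ k" using r p2 by simp
      have "k \<noteq> 0" using n2 n(2) by (intro notI) simp
      moreover from n2 have "k \<noteq> 1" "k \<noteq> 2" "k \<noteq> 3" "k \<noteq> 4" using exc n(2) p2 by (auto split: if_splits)
      ultimately have "5 \<le> k" by simp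
      hence "4 * k + 2 \<le> 2 ^ k" by (induction k rule: dec_induct) auto
      thus ?thesis using n2 by simp
    next
      case False
      hence r3: "3 \<le> r" using r r0 p2 by (cases "r = 2") auto
      have "k \<noteq> 0" using r n p2 by (cases k) auto
      hence "1 \<le> k" by simp
      hence "4 * k + 2 \<le> 2 ^ k * 3" by (induction k rule: dec_induct) auto
      also have "\<dots> \<le> n" unfolding r(1) p2 by (intro mult_le_mono r3) auto
      finally show ?thesis .
    qed
  qed
  thus ?thesis by (simp add: k_def)
qed

section \<open>The exceptional exponents at the prime 2\<close>

text \<open>Since a/b = a b^(n-1) / b^n, only integers have to be approximated.\<close>

lemma dense_power_sums_2I:
  assumes n: "n > 0" and m: "m > 0"
    and int: "\<And>e c. odd c \<Longrightarrow> \<exists>t u. padic_adherent 2 (power_sums m n) t \<and>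
      padic_adherent 2 (power_sums m n) u \<and> u \<noteq> 0 \<and> 2 ^ e * c * u = t"
  shows "dense_in_Qp 2 (ratio_set (power_sums m n))"
proof (rule dense_ratio_setI[where s = 1])
  show "0 \<in> power_sums m n" "1 \<in> power_sums m n"
    using le_in_power_sums n m by auto
  fix a b :: int assume ab: "a \<noteq> 0" "b > 0"
  have "a * b ^ (n - 1) \<noteq> 0" using ab by simp
  then obtain e c where ec: "a * b ^ (n - 1) = 2 ^ e * c" "odd c"
    using multiplicity_decompose'[of "a * b ^ (n - 1)" 2] by (metis odd_one one_dvd)
  obtain t u where tu: "padic_adherent 2 (power_sums m n) t"
      "padic_adherent 2 (power_sums m n) u" "u \<noteq> 0" "2 ^ e * c * u = t"
    using int ec(2) by blast
  have "a * (b ^ n * u) = a * b ^ (n - 1) * u * b" using n by (cases n) auto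
  also have "\<dots> = t * b" using tu(4) ec(1) by simp
  finally show "\<exists>t u. padic_adherent 2 (power_sums m n) t \<and>
      padic_adherent 2 (power_sums m n) u \<and> u \<noteq> 0 \<and> a * u = t * b"
    using tu ab padic_adherent_power_mult[OF tu(2), of "nat b"]
    by (intro exI[of _ t] exI[of _ "b ^ n * u"]) auto
qed auto

text \<open>Only \<open>e\<close> modulo \<open>n\<close> matters, up to n-th powers. A small
  residue \<open>d\<close> is reached with numerator \<open>2 ^ h * c\<close> and denominator
  \<open>2 ^ (h - d)\<close>; a large one with the roles exchanged, the odd part now sitting in the
  denominator.\<close>

lemma dense_power_sums_2_evenI:
  assumes n: "n > 0" "even n" "n \<le> 2 * h" and m: "2 ^ h \<le> m"
    and adh: "\<And>c. odd c \<Longrightarrow> padic_adherent 2 (power_sums m n) (2 ^ h * c)"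
  shows "dense_in_Qp 2 (ratio_set (power_sums m n))"
proof (rule dense_power_sums_2I)
  show "m > 0" using m by (metis gr0I le_zero_eq power_not_zero zero_neq_numeral)
  have two: "padic_adherent 2 (power_sums m n) (2 ^ j)" if "j \<le> h" for j
  proof -
    have "(2::nat) ^ j \<le> 2 ^ h" using that by (intro power_increasing) auto
    hence "2 ^ j \<in> power_sums m n" by (intro le_in_power_sums le_trans[OF _ m] n)
    from padic_adherentI[OF this] show ?thesis by simp
  qed
  fix e :: nat and c :: int assume c: "odd c"
  define s d where "s = e div n" and "d = e mod n"
  have e: "e = s * n + d" and d: "d < n" using n by (auto simp: s_def d_def)
  show "\<exists>t u. padic_adherent 2 (power_sums m n) t \<and>
      padic_adherent 2 (power_sums m n) u \<and> u \<noteq> 0 \<and> 2 ^ e * c * u = t"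
  proof (cases "d \<le> h")
    case True
    have "padic_adherent 2 (power_sums m n) ((2 ^ s) ^ n * (2 ^ h * c))"
      using padic_adherent_power_mult[OF adh[OF c], of "2 ^ s"] by simp
    moreover have "2 ^ e * c * 2 ^ (h - d) = (2 ^ s) ^ n * (2 ^ h * c)"
      using power_add[of "2::int" d "h - d"] True by (simp add: e power_add power_mult)
    ultimately show ?thesis using two[of "h - d"] by (metis diff_le_self power_not_zero zero_neq_numeral)
  next
    case False
    \<comment> \<open>Here \<open>d > h\<close> and \<open>n \<le> 2 * h\<close> give
      \<open>h + d > n\<close>, so the subtraction is not truncated, while \<open>d < n\<close>
      gives \<open>j \<le> h\<close>.\<close>
    define j where "j = h + d - n"
    have j: "d + h = n + j" "j \<le> h" using False n d by (auto simp: j_def)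
    have "padic_adherent 2 (power_sums m n) ((2 ^ Suc s * \<bar>c\<bar>) ^ n * 2 ^ j)"
      using padic_adherent_power_mult[OF two[OF j(2)], of "2 ^ Suc s * nat \<bar>c\<bar>"] by simp
    \<comment> \<open>The denominator \<open>2 ^ h * c ^ (n - 1)\<close> completes \<open>c\<close>
      to an n-th power. Its base may be taken as the absolute value because \<open>n\<close> is
      even.\<close>
    moreover have "2 ^ e * c * (2 ^ h * c ^ (n - 1)) = (2 ^ Suc s * \<bar>c\<bar>) ^ n * 2 ^ j"
    proof -
      have "2 ^ e * c * (2 ^ h * c ^ (n - 1)) = 2 ^ (s * n) * 2 ^ (d + h) * (c * c ^ (n - 1))"
        by (simp add: e power_add)
      also have "c * c ^ (n - 1) = \<bar>c\<bar> ^ n"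
        using n(1) by (simp add: power_even_abs[OF n(2)] flip: power_eq_if power_Suc)
      finally show ?thesis unfolding j(1)
        by (simp add: power_add power_mult_distrib power_mult)
    qed
    moreover have "odd (c ^ (n - 1))" using c by simp
    hence "padic_adherent 2 (power_sums m n) (2 ^ h * c ^ (n - 1))" by (rule adh)
    moreover have "2 ^ h * c ^ (n - 1) \<noteq> 0" using c by auto
    ultimately show ?thesis by blast
  qed
qed (use n in simp)

section \<open>Density in the four exceptional cases\<close>

text \<open>Three squares, one of them odd, reach the residues 1, 2, 3, 5, 6 modulo 8. Up to a power
  of 4 the target is \<open>c\<close> or \<open>2 * c\<close>, and only \<open>c\<close> congruent
  to 7 is missed.\<close>

lemma dense_squares_2:
  assumes m: "m \<ge> 3"
  shows "dense_in_Qp 2 (ratio_set (power_sums m 2))"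
proof (rule dense_power_sums_2I)
  let ?adh = "padic_adherent 2 (power_sums m 2)"
  have mult: "multiplicity 2 (2::nat) = 1" by (simp add: multiplicity_self)
  have three: "?adh t" if "odd x" "[int (x\<^sup>2 + y\<^sup>2 + z\<^sup>2) = t] (mod 8)" for t and x y z :: nat
  proof (rule padic_adherent_mono)
    show "padic_adherent 2 (power_sums 3 2) t"
      using that by (intro padic_adherent_power_sumsI[where i = 0 and
          x = "\<lambda>i. if i = 0 then x else if i = 1 then y else z"])
        (auto simp: mult numeral_3_eq_3 add_ac)
    show "power_sums 3 2 \<subseteq> power_sums m 2" using m by (intro power_sums_mono) auto
  qed
  have adh: "?adh t" if "t mod 8 \<in> {1, 2, 3, 5, 6}" for t
    using that three[of 1 0 0 t] three[of 1 1 0 t] three[of 1 1 1 t] three[of 1 2 0 t] three[of 1 2 1 t]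
    by (auto simp: cong_def)
  fix e :: nat and c :: int assume c: "odd c"
  define s where "s = e div 2"
  have sq: "?adh (2 ^ (s * 2) * t)" if "?adh t" for t
    using padic_adherent_power_mult[OF that, of "2 ^ s"] by (simp add: power_mult)
  have cm: "c mod 8 \<in> {1, 3, 5} \<or> c mod 8 = 7" using odd_mod_4_8(1)[OF c] by blast
  show "\<exists>t u. ?adh t \<and> ?adh u \<and> u \<noteq> 0 \<and> 2 ^ e * c * u = t"
  proof (cases "even e")
    case False
    hence "e = s * 2 + 1" unfolding s_def by (metis mult.commute odd_two_times_div_two_succ)
    moreover have "2 * c mod 8 \<in> {2, 6}"
      using odd_mod_4_8(2)[OF c] mod_mult_mult1[of 2 c 4] by auto
    hence "?adh (2 ^ (s * 2) * (2 * c))" by (intro sq adh) auto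
    ultimately show ?thesis using adh[of 1] by (intro exI[of _ "2 ^ e * c"] exI[of _ 1]) (auto simp: mult_ac)
  next
    case True
    hence e: "e = s * 2" by (simp add: s_def)
    from cm show ?thesis
    proof
      assume "c mod 8 \<in> {1, 3, 5}"
      hence "?adh (2 ^ (s * 2) * c)" by (intro sq adh) auto
      thus ?thesis using adh[of 1] by (intro exI[of _ "2 ^ e * c"] exI[of _ 1]) (auto simp: e)
    next
      \<comment> \<open>The fraction is expanded by 5, since 5 and \<open>7 * 5\<close>, which is 3
        modulo 8, are both reachable.\<close>
      assume "c mod 8 = 7"
      hence "c * 5 mod 8 = 3" using mod_mult_left_eq[of c 8 5] by simp
      hence "?adh (2 ^ (s * 2) * (c * 5))" by (intro sq adh) auto
      thus ?thesis using adh[of 5] by (intro exI[of _ "2 ^ e * c * 5"] exI[of _ 5]) (auto simp: e mult_ac)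
    qed
  qed
qed (use m in auto)

lemma dense_fourth_powers_2:
  assumes m: "m \<ge> 8"
  shows "dense_in_Qp 2 (ratio_set (power_sums m 4))"
proof (rule dense_power_sums_2_evenI[where h = 3])
  have mult: "multiplicity 2 (4::nat) = 2"
    using multiplicity_same_power[of "2::nat" 2] by simp
  fix c :: int assume "odd c"
  hence "c mod 4 \<in> {1, 3}" by (rule odd_mod_4_8)
  moreover have "8 * c mod 32 = 8 * (c mod 4)" using mod_mult_mult1[of 8 c 4] by simp
  ultimately have "8 * c mod 32 \<in> {8, 24}" by auto
  \<comment> \<open>Modulo 32 the fourth powers of 1 and 3 are 1 and 17; seven ones raise them to 8
    and 24.\<close>
  hence "\<exists>z\<in>{1, 3::nat}. [int (z ^ 4 + (8 - 1)) = 8 * c] (mod 32)"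
    by (auto simp: cong_def)
  then obtain z :: nat where "z \<in> {1, 3}" "[int (z ^ 4 + (8 - 1)) = 8 * c] (mod 32)" by blast
  hence "padic_adherent 2 (power_sums 8 4) (8 * c)"
    by (intro padic_adherent_count[where z = z]) (auto simp: mult)
  thus "padic_adherent 2 (power_sums m 4) (2 ^ 3 * c)"
    using padic_adherent_mono power_sums_mono[OF m, of 4] by simp
qed (use m in auto)

lemma dense_eighth_powers_2:
  assumes m: "m \<ge> 16"
  shows "dense_in_Qp 2 (ratio_set (power_sums m 8))"
proof (rule dense_power_sums_2_evenI[where h = 4])
  have mult: "multiplicity 2 (8::nat) = 3"
    using multiplicity_same_power[of "2::nat" 3] by simp
  fix c :: int assume "odd c"
  hence "c mod 8 \<in> {1, 3, 5, 7}" by (rule odd_mod_4_8)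
  moreover have "16 * c mod 128 = 16 * (c mod 8)" using mod_mult_mult1[of 16 c 8] by simp
  ultimately have "16 * c mod 128 \<in> {16, 48, 80, 112}" by auto
  \<comment> \<open>Modulo 128 the eighth powers of 1, 3, 9, 27 are 1, 33, 65, 97; fifteen ones
    raise them to 16, 48, 80, 112.\<close>
  hence "\<exists>z\<in>{1, 3, 9, 27::nat}. [int (z ^ 8 + (16 - 1)) = 16 * c] (mod 128)"
    by (auto simp: cong_def)
  then obtain z :: nat where "z \<in> {1, 3, 9, 27}" "[int (z ^ 8 + (16 - 1)) = 16 * c] (mod 128)"
    by blast
  hence "padic_adherent 2 (power_sums 16 8) (16 * c)"
    by (intro padic_adherent_count[where z = z]) (auto simp: mult)
  thus "padic_adherent 2 (power_sums m 8) (2 ^ 4 * c)"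
    using padic_adherent_mono power_sums_mono[OF m, of 8] by simp
qed (use m in auto)

lemma dense_sixteenth_powers_2:
  assumes m: "m \<ge> 64"
  shows "dense_in_Qp 2 (ratio_set (power_sums m 16))"
proof (rule dense_if_theta_le)
  have mult: "multiplicity 2 (16::nat) = 4"
    using multiplicity_same_power[of "2::nat" 4] by simp
  \<comment> \<open>\<open>5 ^ 16\<close> is 449 modulo 512, so 63 further ones complete it to a
    multiple of 512.\<close>
  have "(\<Sum>i<64::nat. (if i = 0 then 5 else 1) ^ 16) = (5 ^ 16 + 63 :: int)"
    by (subst sum.remove[of _ "0::nat"]) auto
  hence "theta 16 (2 ^ 9) \<le> 64"
    by (intro theta_le[where X = "\<lambda>i. if i = 0 then 5 else 1" and i = 1]) (auto simp: cong_def)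
  thus "theta 16 (2 ^ (2 * multiplicity 2 (16::nat) + 1)) \<le> m" using m by (simp add: mult)
qed auto

theorem theorem1p9:
  fixes m n p k :: nat
  assumes "m \<ge> 2" and "n \<ge> 2" and "prime p"
    and "k = multiplicity p n"
  shows "(m \<ge> theta n (p ^ (2 * k + 1)) \<longrightarrow> dense_in_Qp p (ratio_set (power_sums m n))) \<and>
    (m < theta n (p ^ (2 * k + 1)) \<and> (n, p) \<notin> {(2, 2), (4, 2), (8, 2), (16, 2)} \<longrightarrow>
       \<not> dense_in_Qp p (ratio_set (power_sums m n))) \<and>
    (dense_in_Qp 2 (ratio_set (power_sums m 2)) \<longleftrightarrow> m \<ge> 3) \<and>
    (dense_in_Qp 2 (ratio_set (power_sums m 4)) \<longleftrightarrow> m \<ge> 8) \<and>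
    (dense_in_Qp 2 (ratio_set (power_sums m 8)) \<longleftrightarrow> m \<ge> 16) \<and>
    (dense_in_Qp 2 (ratio_set (power_sums m 16)) \<longleftrightarrow> m \<ge> 64)"
proof (intro conjI impI)
  assume "theta n (p ^ (2 * k + 1)) \<le> m"
  thus "dense_in_Qp p (ratio_set (power_sums m n))" using dense_if_theta_le assms by simp
next
  assume *: "m < theta n (p ^ (2 * k + 1)) \<and> (n, p) \<notin> {(2, 2), (4, 2), (8, 2), (16, 2)}"
  hence "even n" using theta_odd_le_2[of n "p ^ (2 * k + 1)"] assms(1) by linarith
  hence "4 * k + 2 \<le> n" using even_exponent_bound * assms by blast
  moreover have "only_imprimitive m n p (2 * k + 1)"
    using only_imprimitive_if_less_theta * assms by simp
  ultimately show "\<not> dense_in_Qp p (ratio_set (power_sums m n))"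
    using not_dense_exponent_gap[OF assms(3)] assms(2) by simp
next
  have "\<not> dense_in_Qp 2 (ratio_set (power_sums m 2))" if "\<not> m \<ge> 3"
  proof -
    have "m = 2" using that assms(1) by simp
    thus ?thesis using not_dense_minus_one[OF _ _ only_imprimitive_four_squares] by simp
  qed
  thus "dense_in_Qp 2 (ratio_set (power_sums m 2)) \<longleftrightarrow> m \<ge> 3" using dense_squares_2 by blast
next
  have "\<not> dense_in_Qp 2 (ratio_set (power_sums m 4))" if "\<not> m \<ge> 8"
    \<comment> \<open>The counting argument needs \<open>2 * m < 2 ^ 4\<close>, that is
      \<open>m < 8\<close>.\<close>
    using that by (intro not_dense_minus_one[OF _ _ only_imprimitive_two_power[where j = 1]]) auto
  thus "dense_in_Qp 2 (ratio_set (power_sums m 4)) \<longleftrightarrow> m \<ge> 8" using dense_fourth_powers_2 by blast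
next
  have "\<not> dense_in_Qp 2 (ratio_set (power_sums m 8))" if "\<not> m \<ge> 16"
    using that by (intro not_dense_minus_one[OF _ _ only_imprimitive_two_power[where j = 2]]) auto
  thus "dense_in_Qp 2 (ratio_set (power_sums m 8)) \<longleftrightarrow> m \<ge> 16" using dense_eighth_powers_2 by blast
next
  have "\<not> dense_in_Qp 2 (ratio_set (power_sums m 16))" if "\<not> m \<ge> 64"
    \<comment> \<open>The gap criterion counts only \<open>m\<close> bases and so covers all
      \<open>m < 2 ^ 6\<close>; it applies with \<open>L = 6\<close> since
      \<open>2 * 6 \<le> 16\<close>. Testing -1 by the same count would need
      \<open>2 * m < 64\<close>.\<close>
    using that by (intro not_dense_exponent_gap[OF _ only_imprimitive_two_power[where j = 3]]) auto
  thus "dense_in_Qp 2 (ratio_set (power_sums m 16)) \<longleftrightarrow> m \<ge> 64" using dense_sixteenth_powers_2 by blast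
qed

end
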